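(* Let $L\colon A\to\mathbb{R}$ be a linear functional with $L(1)=1$ that is $\sum A^2$-positive and satisfies $\sup_{n\in\mathbb{N}}\sqrt[2n]{L(a^{2n})}<\infty$ for all $a\in A$. Let $\tau_L$ be the topology on $A$ generated by the submultiplicative seminorm $p_L(a):=\sup_{n\in\mathbb{N}}\sqrt[2n]{L(a^{2n})}$, $a\in A$. Then $\tau_L$ is the weakest topology on $A$ such that $(A,\tau_L)$ is a locally multiplicative convex topological algebra and $L$ is $\tau_L$-continuous. (That is, $\tau_L$ has these properties, and $\tau_L\subseteq\tau$ for every topology $\tau$ on $A$ such that $(A,\tau)$ is a locally multiplicative convex topological algebra and $L$ is $\tau$-continuous.)
   Context: $A$ is a unital commutative $\mathbb{R}$-algebra admitting at least one (unital) $\mathbb{R}$-algebra homomorphism to $\mathbb{R}$. $\sum A^2$-positive means $L(a^2)\ge0$ for all $a\in A$. $\mathbb{N}=\{1,2,\dots\}$. A seminorm $p$ on $A$ is submultiplicative if $p(ab)\le p(a)p(b)$ for all $a,b\in A$. $(A,\tau)$ is a locally multiplicative convex topological algebra if $\tau$ is generated by a family of submultiplicative seminorms on $A$ (not necessarily Hausdorff). *)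

theory Defs
  imports "HOL-Analysis.Analysis"
begin

(* The unital commutative real algebra A is a type of sort {real_algebra_1, comm_ring_1}, with
   topologies on A given by values of type 'a topology.  These type classes require 0 \<noteq> 1,
   which holds automatically in a unital algebra with a unital homomorphism to the reals. *)

definition real_character :: "('a::{real_algebra_1,comm_ring_1} \<Rightarrow> real) \<Rightarrow> bool" where
  "real_character \<phi> \<longleftrightarrow> linear \<phi> \<and> \<phi> 1 = 1 \<and> (\<forall>a b. \<phi> (a * b) = \<phi> a * \<phi> b)"

(* Nonnegativity of p follows from these two conditions. *)
definition seminorm :: "('a::real_vector \<Rightarrow> real) \<Rightarrow> bool" where
  "seminorm p \<longleftrightarrow> (\<forall>x y. p (x + y) \<le> p x + p y) \<and> (\<forall>c x. p (c *\<^sub>R x) = \<bar>c\<bar> * p x)"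

definition submultiplicative_seminorm :: "('a::real_algebra \<Rightarrow> real) \<Rightarrow> bool" where
  "submultiplicative_seminorm p \<longleftrightarrow> seminorm p \<and> (\<forall>a b. p (a * b) \<le> p a * p b)"

(* The open balls of the seminorms form a subbasis.  UNIV is inserted so that the empty family
   generates the indiscrete topology on the whole space rather than the topology on the empty set. *)
definition seminorm_topology :: "('a::real_vector \<Rightarrow> real) set \<Rightarrow> 'a topology" where
  "seminorm_topology P =
     topology_generated_by (insert UNIV {{y. p (y - x) < r} |p x r. p \<in> P \<and> 0 < r})"

definition lmc_topology :: "'a::real_algebra topology \<Rightarrow> bool" where
  "lmc_topology \<tau> \<longleftrightarrow>
     (\<exists>P. (\<forall>p\<in>P. submultiplicative_seminorm p) \<and> \<tau> = seminorm_topology P)"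

(* The supremum is meaningful only under the hypothesis that the set is bounded above. *)
definition p_fun :: "('a::{real_algebra_1,comm_ring_1} \<Rightarrow> real) \<Rightarrow> 'a \<Rightarrow> real" where
  "p_fun L a = (SUP n\<in>{1::nat..}. root (2 * n) (L (a ^ (2 * n))))"

definition tau_fun :: "('a::{real_algebra_1,comm_ring_1} \<Rightarrow> real) \<Rightarrow> 'a topology" where
  "tau_fun L = seminorm_topology {p_fun L}"

end

theory Submission
  imports Defs
begin

text \<open>Everything rests on the Cauchy--Schwarz inequality for $L$.  It gives
  $|L(a^i b^j)| \le p_L(a)^i p_L(b)^j$, so expanding $(a+b)^{2n}$ binomially yields
  $L((a+b)^{2n}) \le (p_L(a)+p_L(b))^{2n}$, which is the triangle inequality.  For minimality,
  continuity of $L$ in a locally multiplicative convex topology gives a continuous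
  submultiplicative seminorm $q$ with $|L| \le C q$, where $C \ge 1$; then
  $L(a^{2n}) \le C q(a)^{2n} \le (C q(a))^{2n}$, hence $p_L \le C q$.\<close>

section \<open>Algebraic properties of seminorms\<close>

lemma seminorm_zero: "seminorm p \<Longrightarrow> p 0 = 0"
  unfolding seminorm_def by (metis abs_zero mult_zero_left scaleR_zero_left)

lemma seminorm_triangle: "seminorm p \<Longrightarrow> p (x + y) \<le> p x + p y"
  by (simp add: seminorm_def)

lemma seminorm_scaleR: "seminorm p \<Longrightarrow> p (c *\<^sub>R x) = \<bar>c\<bar> * p x"
  by (simp add: seminorm_def)

lemma seminorm_diff_triangle: "seminorm p \<Longrightarrow> p (z - x) \<le> p (z - y) + p (y - x)"
  using seminorm_triangle[of p "z - y" "y - x"] by simp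

lemma seminorm_nonneg:
  assumes "seminorm p"
  shows "0 \<le> p x"
  using seminorm_triangle[OF assms, of x "- x"] seminorm_scaleR[OF assms, of "- 1" x]
    seminorm_zero[OF assms]
  by simp

text \<open>Exponent 0 is left out because \<open>q 1 \<le> 1\<close> may fail: on the reals, twice
  the absolute value is submultiplicative and takes the value 2 at 1.\<close>

lemma submultiplicative_seminorm_power:
  fixes q :: "'a::real_algebra_1 \<Rightarrow> real"
  assumes q: "submultiplicative_seminorm q"
  shows "q (a ^ Suc n) \<le> q a ^ Suc n"
proof (induction n)
  case (Suc n)
  have "q (a ^ Suc (Suc n)) \<le> q a * q (a ^ Suc n)"
    using q by (simp add: submultiplicative_seminorm_def)
  also have "\<dots> \<le> q a * q a ^ Suc n"
    using Suc q by (intro mult_left_mono) (auto simp: submultiplicative_seminorm_def seminorm_nonneg)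
  finally show ?case by simp
qed simp

text \<open>The cross terms in the product of the two sums are nonnegative, so they can only help.
  Sums serve below to put one ball inside the intersection of two.\<close>

lemma submultiplicative_seminorm_add:
  assumes "submultiplicative_seminorm p" "submultiplicative_seminorm q"
  shows "submultiplicative_seminorm (\<lambda>x. p x + q x)"
proof -
  have sp: "seminorm p" and sq: "seminorm q"
    using assms by (auto simp: submultiplicative_seminorm_def)
  have "p (a * b) + q (a * b) \<le> (p a + q a) * (p b + q b)" for a b
  proof -
    have "p (a * b) + q (a * b) \<le> p a * p b + q a * q b"
      using assms by (intro add_mono) (auto simp: submultiplicative_seminorm_def)
    moreover have "0 \<le> p a * q b" "0 \<le> q a * p b"
      using sp sq by (simp_all add: seminorm_nonneg)
    ultimately show ?thesis by (simp add: algebra_simps)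
  qed
  moreover have "p (x + y) + q (x + y) \<le> (p x + q x) + (p y + q y)" for x y
    using seminorm_triangle[OF sp, of x y] seminorm_triangle[OF sq, of x y] by linarith
  ultimately show ?thesis
    using sp sq
    by (auto simp: submultiplicative_seminorm_def seminorm_def distrib_left)
qed

section \<open>Open sets in topologies generated by seminorms\<close>

lemma topspace_seminorm_topology [simp]: "topspace (seminorm_topology P) = UNIV"
  by (auto simp: seminorm_topology_def)

lemma openin_seminorm_topologyI:
  assumes "\<And>x. x \<in> U \<Longrightarrow> \<exists>p\<in>P. seminorm p \<and> (\<exists>e>0. {z. p (z - x) < e} \<subseteq> U)"
  shows "openin (seminorm_topology P) U"
proof (subst openin_subopen, intro ballI)
  fix x assume "x \<in> U"
  then obtain p e where p: "p \<in> P" "seminorm p" "0 < e" "{z. p (z - x) < e} \<subseteq> U"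
    using assms by metis
  have "openin (seminorm_topology P) {z. p (z - x) < e}"
    unfolding seminorm_topology_def using p by (intro topology_generated_by_Basis) blast
  then show "\<exists>T. openin (seminorm_topology P) T \<and> x \<in> T \<and> T \<subseteq> U"
    using p seminorm_zero[OF p(2)] by (intro exI[of _ "{z. p (z - x) < e}"]) auto
qed

text \<open>Around each point \<open>y\<close> of the \<open>p\<close>-ball, the remaining slack
  \<open>r - p (y - x)\<close> divided by \<open>C\<close> is the radius of a \<open>q\<close>-ball
  that still fits inside.\<close>

lemma openin_ball_of_dominated_seminorm:
  assumes p: "seminorm p" and q: "seminorm q"
    and open_q: "\<And>x r. 0 < r \<Longrightarrow> openin \<tau> {z. q (z - x) < r}"
    and C: "0 < C" and le: "\<And>x. p x \<le> C * q x"
  shows "openin \<tau> {z. p (z - x) < r}"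
proof (subst openin_subopen, intro ballI)
  fix y assume "y \<in> {z. p (z - x) < r}"
  then have e: "0 < (r - p (y - x)) / C" using C by simp
  have "p (z - x) < r" if "q (z - y) < (r - p (y - x)) / C" for z
    using seminorm_diff_triangle[OF p, of z x y] le[of "z - y"] that C
    by (simp add: field_simps)
  then show "\<exists>T. openin \<tau> T \<and> y \<in> T \<and> T \<subseteq> {z. p (z - x) < r}"
    using open_q[OF e] e seminorm_zero[OF q]
    by (intro exI[of _ "{z. q (z - y) < (r - p (y - x)) / C}"]) auto
qed

lemma openin_ball_add_seminorm:
  assumes p: "seminorm p" and q: "seminorm q"
    and open_p: "\<And>x r. 0 < r \<Longrightarrow> openin \<tau> {z. p (z - x) < r}"
    and open_q: "\<And>x r. 0 < r \<Longrightarrow> openin \<tau> {z. q (z - x) < r}"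
  shows "openin \<tau> {z. p (z - x) + q (z - x) < r}"
proof (subst openin_subopen, intro ballI)
  fix y assume y: "y \<in> {z. p (z - x) + q (z - x) < r}"
  \<comment> \<open>Half of the slack at \<open>y\<close>, one half for each seminorm.\<close>
  define e where "e = (r - (p (y - x) + q (y - x))) / 2"
  have e: "0 < e" using y by (simp add: e_def)
  have "p (z - x) + q (z - x) < r" if "p (z - y) < e" "q (z - y) < e" for z
    using seminorm_diff_triangle[OF p, of z x y] seminorm_diff_triangle[OF q, of z x y] that
    unfolding e_def by (simp add: field_simps)
  then show "\<exists>T. openin \<tau> T \<and> y \<in> T \<and> T \<subseteq> {z. p (z - x) + q (z - x) < r}"
    using openin_Int[OF open_p[OF e] open_q[OF e]] e seminorm_zero[OF p] seminorm_zero[OF q]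
    by (intro exI[of _ "{z. p (z - y) < e} \<inter> {z. q (z - y) < e}"]) auto
qed

text \<open>The balls of \<open>P\<close> are only a subbasis, so a neighbourhood may involve
  several seminorms; adding them leaves a single \<open>q\<close>. This \<open>q\<close> need not
  lie in \<open>P\<close>, hence the openness of its balls is carried through the induction.\<close>

lemma seminorm_topology_neighbourhood:
  fixes P :: "('a::real_algebra \<Rightarrow> real) set"
  assumes P: "\<forall>p\<in>P. submultiplicative_seminorm p"
    and U: "openin (seminorm_topology P) U" "x \<in> U"
  shows "\<exists>q r. submultiplicative_seminorm q \<and> 0 < r \<and> {z. q (z - x) < r} \<subseteq> U \<and>
    (\<forall>y s. 0 < s \<longrightarrow> openin (seminorm_topology P) {z. q (z - y) < s})"
proof -
  have "generate_topology_on (insert UNIV {{y. p (y - x) < r} |p x r. p \<in> P \<and> 0 < r}) U"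
    using U(1) by (simp add: seminorm_topology_def openin_topology_generated_by_iff)
  then show ?thesis using U(2)
  proof (induction arbitrary: x rule: generate_topology_on.induct)
    case Empty
    then show ?case by simp
  next
    case (Int U V)
    obtain p r where p: "submultiplicative_seminorm p" "0 < r" "{z. p (z - x) < r} \<subseteq> U"
      and open_p: "\<And>y s. 0 < s \<Longrightarrow> openin (seminorm_topology P) {z. p (z - y) < s}"
      using Int.IH(1)[of x] Int.prems by auto
    obtain q s where q: "submultiplicative_seminorm q" "0 < s" "{z. q (z - x) < s} \<subseteq> V"
      and open_q: "\<And>y s. 0 < s \<Longrightarrow> openin (seminorm_topology P) {z. q (z - y) < s}"
      using Int.IH(2)[of x] Int.prems by auto
    have sp: "seminorm p" and sq: "seminorm q"
      using p q by (auto simp: submultiplicative_seminorm_def)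
    have "{z. p (z - x) + q (z - x) < min r s} \<subseteq> U \<inter> V"
    proof
      fix z assume "z \<in> {z. p (z - x) + q (z - x) < min r s}"
      then have "p (z - x) < r" "q (z - x) < s"
        using seminorm_nonneg[OF sp, of "z - x"] seminorm_nonneg[OF sq, of "z - x"] by auto
      then show "z \<in> U \<inter> V" using p(3) q(3) by auto
    qed
    moreover have "openin (seminorm_topology P) {z. p (z - y) + q (z - y) < t}" for y t
      using openin_ball_add_seminorm[OF sp sq open_p open_q] .
    ultimately show ?case
      using submultiplicative_seminorm_add[OF p(1) q(1)] p(2) q(2)
      by (intro exI[of _ "\<lambda>x. p x + q x"] exI[of _ "min r s"]) auto
  next
    case (UN K)
    then obtain V where V: "V \<in> K" "x \<in> V" by auto
    show ?case using UN.IH[OF V] Union_upper[OF V(1)] by (meson order_trans)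
  next
    case (Basis V)
    from Basis.hyps consider "V = UNIV"
      | p y r where "V = {z. p (z - y) < r}" "p \<in> P"
      by auto
    then show ?case
    proof cases
      case 1
      \<comment> \<open>The zero seminorm has the whole space as its unit ball; this also covers an
        empty \<open>P\<close>.\<close>
      have "submultiplicative_seminorm (\<lambda>x::'a. 0)"
        by (simp add: submultiplicative_seminorm_def seminorm_def)
      moreover have "openin (seminorm_topology P) UNIV"
        by (metis openin_topspace topspace_seminorm_topology)
      ultimately show ?thesis
        using 1 by (intro exI[of _ "\<lambda>x. 0"] exI[of _ 1]) auto
    next
      case 2
      have p: "submultiplicative_seminorm p" using P 2 by blast
      then have sp: "seminorm p" by (simp add: submultiplicative_seminorm_def)
      have "{z. p (z - x) < r - p (x - y)} \<subseteq> V"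
      proof
        fix z assume "z \<in> {z. p (z - x) < r - p (x - y)}"
        then show "z \<in> V"
          using seminorm_diff_triangle[OF sp, of z y x] 2 by simp
      qed
      moreover have "0 < r - p (x - y)" using Basis.prems 2 by simp
      moreover have "openin (seminorm_topology P) {z. p (z - w) < s}" if "0 < s" for w s
        unfolding seminorm_topology_def
        using 2 that by (intro topology_generated_by_Basis) blast
      ultimately show ?thesis using p by blast
    qed
  qed
qed

text \<open>Rescale \<open>z\<close> into the ball on which \<open>f\<close> is controlled, then use
  homogeneity.\<close>

lemma linear_bounded_by_seminorm:
  fixes f :: "'a::real_vector \<Rightarrow> real"
  assumes f: "linear f" and q: "seminorm q" and r: "0 < r"
    and bd: "\<And>z. q z < r \<Longrightarrow> \<bar>f z\<bar> < 1"
  shows "\<bar>f z\<bar> \<le> q z / r"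
proof (rule field_le_epsilon)
  fix e :: real assume e: "0 < e"
  \<comment> \<open>Adding \<open>e\<close> keeps the scaling factor positive even if
    \<open>q z = 0\<close>, and makes the inequality \<open>q z < r * t\<close> strict.\<close>
  define t where "t = q z / r + e"
  have t: "0 < t" using e r seminorm_nonneg[OF q, of z] by (simp add: t_def add_nonneg_pos)
  have "q z < r * t" using r e by (simp add: t_def field_simps)
  then have "q ((1 / t) *\<^sub>R z) < r"
    using t by (simp add: seminorm_scaleR[OF q] field_simps)
  then have "\<bar>f ((1 / t) *\<^sub>R z)\<bar> < 1" by (rule bd)
  then show "\<bar>f z\<bar> \<le> q z / r + e"
    using t unfolding t_def[symmetric]
    by (simp add: linear_scale[OF f] abs_mult field_simps)
qed

section \<open>Cauchy-Schwarz inequality for a positive functional\<close>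

locale bounded_power_functional =
  fixes L :: "'a::{real_algebra_1,comm_ring_1} \<Rightarrow> real"
  assumes linear: "linear L"
    and one: "L 1 = 1"
    and square_nonneg: "\<And>a. 0 \<le> L (a\<^sup>2)"
    and bdd: "\<And>a. bdd_above ((\<lambda>n. root (2 * n) (L (a ^ (2 * n)))) ` {1::nat..})"
begin

lemma even_power_nonneg: "0 \<le> L (a ^ (2 * n))"
  using square_nonneg[of "a ^ n"] by (simp add: power_mult[symmetric] mult.commute)

text \<open>The quadratic form \<open>L ((s *\<^sub>R a + t *\<^sub>R b)\<^sup>2)\<close> in
  \<open>s\<close> and \<open>t\<close> is nonnegative; it suffices to evaluate it at one
  well-chosen point.\<close>

lemma Cauchy_Schwarz: "(L (a * b))\<^sup>2 \<le> L (a\<^sup>2) * L (b\<^sup>2)"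
proof -
  have expand: "L ((s *\<^sub>R a + t *\<^sub>R b)\<^sup>2) = s\<^sup>2 * L (a\<^sup>2) + 2 * s * t * L (a * b) + t\<^sup>2 * L (b\<^sup>2)"
    for s t
  proof -
    have "(s *\<^sub>R a + t *\<^sub>R b)\<^sup>2
        = (s\<^sup>2) *\<^sub>R a\<^sup>2 + (2 * s * t) *\<^sub>R (a * b) + (t\<^sup>2) *\<^sub>R b\<^sup>2"
      by (simp add: power2_sum power_mult_distrib scaleR_conv_of_real algebra_simps)
    then show ?thesis by (simp add: linear_add[OF linear] linear_scale[OF linear])
  qed
  show ?thesis
  proof (cases "L (b\<^sup>2) = 0")
    case True
    have "L (a * b) = 0"
    proof (rule ccontr)
      assume ne: "L (a * b) \<noteq> 0"
      show False
        \<comment> \<open>With \<open>L (b\<^sup>2) = 0\<close> the form is affine in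
          \<open>t\<close> for \<open>s = 1\<close>; this \<open>t\<close> gives it the value
          -1.\<close>
        using square_nonneg[of "1 *\<^sub>R a + (- (L (a\<^sup>2) + 1) / (2 * L (a * b))) *\<^sub>R b"] ne
        unfolding expand True by (simp add: field_simps)
    qed
    then show ?thesis using True by simp
  next
    case False
    then have pos: "0 < L (b\<^sup>2)" using square_nonneg[of b] by simp
    \<comment> \<open>The minimiser for \<open>s = 1\<close> is
      \<open>t = - L (a * b) / L (b\<^sup>2)\<close>; both coefficients are multiplied by
      \<open>L (b\<^sup>2)\<close> to avoid the division.\<close>
    have "0 \<le> L ((L (b\<^sup>2) *\<^sub>R a + (- L (a * b)) *\<^sub>R b)\<^sup>2)" by (rule square_nonneg)
    also have "\<dots> = L (b\<^sup>2) * (L (a\<^sup>2) * L (b\<^sup>2) - (L (a * b))\<^sup>2)"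
      unfolding expand by (simp add: power2_eq_square algebra_simps)
    finally show ?thesis using pos by (simp add: zero_le_mult_iff)
  qed
qed

section \<open>Seminorm properties of p_L\<close>

lemma root_le_p_fun: "1 \<le> n \<Longrightarrow> root (2 * n) (L (a ^ (2 * n))) \<le> p_fun L a"
  unfolding p_fun_def by (rule cSUP_upper[OF _ bdd]) simp

lemma p_fun_le: "(\<And>n. 1 \<le> n \<Longrightarrow> root (2 * n) (L (a ^ (2 * n))) \<le> c) \<Longrightarrow> p_fun L a \<le> c"
  unfolding p_fun_def by (rule cSUP_least) auto

text \<open>Reduces every upper bound on the supremum to a root-free estimate of \<open>L\<close> on
  even powers; \<open>0 \<le> c\<close> ensures that the root of \<open>c ^ (2 * n)\<close> is
  \<open>c\<close> itself.\<close>

lemma p_fun_le_of_power_le: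
  assumes c: "0 \<le> c" and le: "\<And>n. 1 \<le> n \<Longrightarrow> L (a ^ (2 * n)) \<le> c ^ (2 * n)"
  shows "p_fun L a \<le> c"
proof (rule p_fun_le)
  fix n :: nat assume n: "1 \<le> n"
  have "root (2 * n) (L (a ^ (2 * n))) \<le> root (2 * n) (c ^ (2 * n))"
    using n le by (intro real_root_le_mono) auto
  then show "root (2 * n) (L (a ^ (2 * n))) \<le> c"
    using n c by (simp add: real_root_power_cancel)
qed

lemma p_fun_nonneg: "0 \<le> p_fun L a"
  using root_le_p_fun[of 1 a] real_root_ge_zero[OF even_power_nonneg, of "2 * 1" a 1] by linarith

text \<open>For \<open>n = 0\<close>, which the supremum does not range over, both sides are 1. This
  case lets the mixed bound below include vanishing exponents.\<close>

lemma even_power_le: "L (a ^ (2 * n)) \<le> p_fun L a ^ (2 * n)"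
proof (cases "n = 0")
  case False
  have "L (a ^ (2 * n)) = root (2 * n) (L (a ^ (2 * n))) ^ (2 * n)"
    using False even_power_nonneg by (intro real_root_pow_pos2[symmetric]) auto
  also have "\<dots> \<le> p_fun L a ^ (2 * n)"
    using False by (intro power_mono root_le_p_fun real_root_ge_zero even_power_nonneg) auto
  finally show ?thesis .
qed (simp add: one)

text \<open>Cauchy-Schwarz for \<open>a ^ i\<close> and \<open>b ^ j\<close> leaves only even powers
  of a single element, whatever the parity of \<open>i\<close> and \<open>j\<close>. The triangle
  inequality, submultiplicativity and \<open>\<bar>L a\<bar> \<le> p_fun L a\<close> all follow from
  this bound.\<close>

lemma abs_le_p_fun_powers: "\<bar>L (a ^ i * b ^ j)\<bar> \<le> p_fun L a ^ i * p_fun L b ^ j"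
proof (rule power2_le_imp_le)
  have "\<bar>L (a ^ i * b ^ j)\<bar>\<^sup>2 \<le> L (a ^ (2 * i)) * L (b ^ (2 * j))"
    using Cauchy_Schwarz[of "a ^ i" "b ^ j"] by (simp add: power_mult[symmetric] mult.commute)
  also have "\<dots> \<le> p_fun L a ^ (2 * i) * p_fun L b ^ (2 * j)"
    by (intro mult_mono even_power_le even_power_nonneg zero_le_power p_fun_nonneg)
  also have "\<dots> = (p_fun L a ^ i * p_fun L b ^ j)\<^sup>2"
    by (simp add: power_mult_distrib power_mult[symmetric] mult.commute)
  finally show "\<bar>L (a ^ i * b ^ j)\<bar>\<^sup>2 \<le> (p_fun L a ^ i * p_fun L b ^ j)\<^sup>2" .
qed (simp add: p_fun_nonneg)

lemma abs_le_p_fun: "\<bar>L a\<bar> \<le> p_fun L a"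
  using abs_le_p_fun_powers[of a 1 1 0] by simp

lemma p_fun_mult: "p_fun L (a * b) \<le> p_fun L a * p_fun L b"
proof (rule p_fun_le_of_power_le)
  fix n :: nat
  show "L ((a * b) ^ (2 * n)) \<le> (p_fun L a * p_fun L b) ^ (2 * n)"
    using abs_le_p_fun_powers[of a "2 * n" b "2 * n"] by (simp add: power_mult_distrib)
qed (simp add: p_fun_nonneg)

lemma p_fun_add: "p_fun L (a + b) \<le> p_fun L a + p_fun L b"
proof (rule p_fun_le_of_power_le)
  fix n :: nat
  have "L ((a + b) ^ (2 * n)) = L (\<Sum>k\<le>2 * n. real (2 * n choose k) *\<^sub>R (a ^ k * b ^ (2 * n - k)))"
    by (simp add: binomial_ring scaleR_conv_of_real mult.assoc)
  also have "\<dots> = (\<Sum>k\<le>2 * n. real (2 * n choose k) * L (a ^ k * b ^ (2 * n - k)))"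
    by (simp add: linear_sum[OF linear] linear_scale[OF linear])
  \<comment> \<open>Terms with odd \<open>k\<close> may have either sign, so the bound goes through
    absolute values.\<close>
  also have "\<dots> \<le> (\<Sum>k\<le>2 * n. real (2 * n choose k) * (p_fun L a ^ k * p_fun L b ^ (2 * n - k)))"
    by (intro sum_mono mult_left_mono order_trans[OF abs_ge_self abs_le_p_fun_powers]) simp
  also have "\<dots> = (p_fun L a + p_fun L b) ^ (2 * n)"
    by (simp add: binomial_ring mult.assoc)
  finally show "L ((a + b) ^ (2 * n)) \<le> (p_fun L a + p_fun L b) ^ (2 * n)" .
qed (simp add: p_fun_nonneg)

lemma p_fun_scaleR_le: "p_fun L (c *\<^sub>R a) \<le> \<bar>c\<bar> * p_fun L a"
proof (rule p_fun_le_of_power_le)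
  fix n :: nat
  have "(c *\<^sub>R a) ^ (2 * n) = (c ^ (2 * n)) *\<^sub>R a ^ (2 * n)"
    by (simp only: scaleR_conv_of_real power_mult_distrib of_real_power)
  then have "L ((c *\<^sub>R a) ^ (2 * n)) = c ^ (2 * n) * L (a ^ (2 * n))"
    by (simp add: linear_scale[OF linear])
  also have "\<dots> \<le> c ^ (2 * n) * p_fun L a ^ (2 * n)"
    by (intro mult_left_mono even_power_le) simp
  finally show "L ((c *\<^sub>R a) ^ (2 * n)) \<le> (\<bar>c\<bar> * p_fun L a) ^ (2 * n)"
    by (simp only: power_mult_distrib power_even_abs[OF dvd_triv_left])
qed (simp add: p_fun_nonneg)

text \<open>For \<open>c \<noteq> 0\<close>, the reverse inequality is the previous bound applied to
  the scalar \<open>1 / c\<close> and the vector \<open>c *\<^sub>R a\<close>.\<close>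

lemma p_fun_scaleR: "p_fun L (c *\<^sub>R a) = \<bar>c\<bar> * p_fun L a"
proof (rule antisym[OF p_fun_scaleR_le])
  show "\<bar>c\<bar> * p_fun L a \<le> p_fun L (c *\<^sub>R a)"
  proof (cases "c = 0")
    case False
    then show ?thesis
      using p_fun_scaleR_le[of "1 / c" "c *\<^sub>R a"] by (simp add: field_simps)
  qed (simp add: p_fun_nonneg)
qed

lemma submultiplicative_seminorm_p_fun: "submultiplicative_seminorm (p_fun L)"
  by (simp add: submultiplicative_seminorm_def seminorm_def p_fun_add p_fun_scaleR p_fun_mult)

lemma seminorm_p_fun: "seminorm (p_fun L)"
  using submultiplicative_seminorm_p_fun by (simp add: submultiplicative_seminorm_def)

section \<open>Continuity of L and minimality of tau_L\<close>

lemma continuous_map_tau_fun: "continuous_map (tau_fun L) euclideanreal L"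
proof -
  have "openin (tau_fun L) {x. L x \<in> V}" if "open V" for V
    unfolding tau_fun_def
  proof (rule openin_seminorm_topologyI)
    fix x assume "x \<in> {x. L x \<in> V}"
    then obtain e where e: "0 < e" "\<And>y. dist y (L x) < e \<Longrightarrow> y \<in> V"
      using \<open>open V\<close> by (auto simp: open_dist)
    have "L z \<in> V" if "p_fun L (z - x) < e" for z
      using e(2)[of "L z"] abs_le_p_fun[of "z - x"] that
      by (simp add: dist_real_def linear_diff[OF linear])
    then show "\<exists>p\<in>{p_fun L}. seminorm p \<and> (\<exists>e>0. {z. p (z - x) < e} \<subseteq> {x. L x \<in> V})"
      using e(1) seminorm_p_fun by auto
  qed
  then show ?thesis by (simp add: continuous_map_def tau_fun_def)
qed

lemma p_fun_le_submultiplicative_seminorm: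
  assumes q: "submultiplicative_seminorm q" and C: "1 \<le> C"
    and le: "\<And>a. \<bar>L a\<bar> \<le> C * q a"
  shows "p_fun L a \<le> C * q a"
proof (rule p_fun_le_of_power_le)
  have q0: "0 \<le> q a" using q by (simp add: submultiplicative_seminorm_def seminorm_nonneg)
  then show "0 \<le> C * q a" using C by simp
  fix n :: nat assume n: "1 \<le> n"
  \<comment> \<open>The power estimate for \<open>q\<close> is stated for successor exponents
    only.\<close>
  then obtain m where m: "2 * n = Suc m" by (cases "2 * n") auto
  have "L (a ^ (2 * n)) \<le> C * q (a ^ (2 * n))"
    using le[of "a ^ (2 * n)"] by simp
  also have "\<dots> \<le> C ^ (2 * n) * q a ^ (2 * n)"
  proof (rule mult_mono)
    show "C \<le> C ^ (2 * n)" using C n by (intro self_le_power) auto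
    show "q (a ^ (2 * n)) \<le> q a ^ (2 * n)"
      unfolding m by (rule submultiplicative_seminorm_power[OF q])
  qed (use q C in \<open>auto simp: submultiplicative_seminorm_def seminorm_nonneg\<close>)
  finally show "L (a ^ (2 * n)) \<le> (C * q a) ^ (2 * n)" by (simp add: power_mult_distrib)
qed

lemma tau_fun_coarsest:
  assumes \<tau>: "lmc_topology \<tau>" and cont: "continuous_map \<tau> euclideanreal L"
    and U: "openin (tau_fun L) U"
  shows "openin \<tau> U"
proof -
  obtain P where P: "\<forall>p\<in>P. submultiplicative_seminorm p" and \<tau>_def: "\<tau> = seminorm_topology P"
    using \<tau> by (auto simp: lmc_topology_def)
  \<comment> \<open>Continuity at 0 is all that is needed: a \<open>q\<close>-ball inside this
    preimage bounds \<open>L\<close> by a multiple of \<open>q\<close>.\<close>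
  let ?U = "{x. L x \<in> {-1<..<1}}"
  have "openin \<tau> ?U"
    using openin_continuous_map_preimage[OF cont, of "{-1<..<1}"] by (simp add: \<tau>_def)
  moreover have "0 \<in> ?U" using linear_0[OF linear] by simp
  ultimately have "\<exists>q r. submultiplicative_seminorm q \<and> 0 < r \<and> {z. q (z - 0) < r} \<subseteq> ?U \<and>
      (\<forall>y s. 0 < s \<longrightarrow> openin \<tau> {z. q (z - y) < s})"
    unfolding \<tau>_def by (rule seminorm_topology_neighbourhood[OF P])
  then obtain q r where q: "submultiplicative_seminorm q" "0 < r"
      and sub: "{z. q (z - 0) < r} \<subseteq> ?U"
      and open_q: "\<And>y s. 0 < s \<Longrightarrow> openin \<tau> {z. q (z - y) < s}"
    by blast
  have sq: "seminorm q" using q by (simp add: submultiplicative_seminorm_def)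
  \<comment> \<open>The maximum with 1 secures \<open>C \<le> C ^ (2 * n)\<close> when
    \<open>C\<close> is absorbed into the power.\<close>
  define C where "C = max 1 (1 / r)"
  have C: "1 \<le> C" by (simp add: C_def)
  have "\<bar>L a\<bar> \<le> C * q a" for a
  proof -
    have "\<bar>L a\<bar> \<le> q a / r"
    proof (rule linear_bounded_by_seminorm[OF linear sq q(2)])
      fix z assume "q z < r"
      then have "z \<in> ?U" using sub by auto
      then show "\<bar>L z\<bar> < 1" by auto
    qed
    also have "\<dots> \<le> C * q a"
      using mult_right_mono[of "1 / r" C "q a"] seminorm_nonneg[OF sq, of a] by (simp add: C_def)
    finally show ?thesis .
  qed
  then have le: "p_fun L a \<le> C * q a" for a
    by (rule p_fun_le_submultiplicative_seminorm[OF q(1) C])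
  have balls: "openin \<tau> {z. p_fun L (z - x) < s}" for x s
    by (rule openin_ball_of_dominated_seminorm[OF seminorm_p_fun sq open_q _ le]) (use C in auto)
  have UNIV: "openin \<tau> UNIV" by (metis \<tau>_def openin_topspace topspace_seminorm_topology)
  show ?thesis
  \<comment> \<open>It suffices that \<tau> contains the generating sets of
    \<open>tau_fun L\<close>, namely the whole space and the balls of
    \<open>p_fun L\<close>.\<close>
  proof (rule generate_topology_on_coarsest[OF istopology_openin])
    show "generate_topology_on (insert UNIV {{y. p (y - x) < r} |p x r. p \<in> {p_fun L} \<and> 0 < r}) U"
      using U unfolding tau_fun_def seminorm_topology_def openin_topology_generated_by_iff .
  qed (use UNIV balls in blast)
qed

end

theorem proposition4p2:
  fixes L :: "'a::{real_algebra_1,comm_ring_1} \<Rightarrow> real"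
  assumes "\<exists>\<phi>::'a \<Rightarrow> real. real_character \<phi>"
    and "linear L"
    and "L 1 = 1"
    and "\<And>a. 0 \<le> L (a\<^sup>2)"
    and "\<And>a. bdd_above ((\<lambda>n. root (2 * n) (L (a ^ (2 * n)))) ` {1::nat..})"
  shows "submultiplicative_seminorm (p_fun L) \<and>
    lmc_topology (tau_fun L) \<and>
    continuous_map (tau_fun L) euclideanreal L \<and>
    (\<forall>\<tau>. lmc_topology \<tau> \<and> continuous_map \<tau> euclideanreal L \<longrightarrow>
      (\<forall>U. openin (tau_fun L) U \<longrightarrow> openin \<tau> U))"
proof -
  interpret bounded_power_functional L
    using assms(2-5) by (rule bounded_power_functional.intro)
  have "lmc_topology (tau_fun L)"
    using submultiplicative_seminorm_p_fun by (auto simp: lmc_topology_def tau_fun_def)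
  then show ?thesis
    using submultiplicative_seminorm_p_fun continuous_map_tau_fun tau_fun_coarsest by blast
qed

end
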